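(* The following statements are equivalent for a graph $G$: (i) $G$ is $\{W_4, \text{dart}, \text{gem}\}$-free; (ii) every induced diamond of $G$ contains a pair of twin vertices (twins in $G$); (iii) every vertex of $G$ is block separable.
   Context: All graphs are finite and simple. $N(v)$ is the open and $N[v]=N(v)\cup\{v\}$ the closed neighborhood. Vertices $v,w$ are twins if $N[v]=N[w]$. A vertex $w$ dominates $v$ if $N[v]\subseteq N[w]$. A vertex $v$ is block separable if every pair of adjacent vertices $w,z\in N(v)$ that do not dominate $v$ are twins in the induced subgraph $G[N(v)]$. The diamond is $K_4$ minus an edge; $W_4$ is the 4-cycle plus a vertex adjacent to all four cycle vertices; the gem is the path $P_4$ plus a vertex adjacent to all four path vertices; the dart is a diamond together with an extra vertex adjacent only to one of the two degree-3 vertices of the diamond. $\{W_4,\text{dart},\text{gem}\}$-free means no induced subgraph isomorphic to any of these. *)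

theory Defs
  imports "Graph_Theory.Graph_Theory"
begin

text \<open>
  A finite simple graph is a \<open>G\<close> with \<open>graph G\<close>: a finite symmetric digraph without loops or
  parallel arcs, each undirected edge being a pair of opposite arcs.
\<close>

definition open_nbhd :: "('a, 'b) pre_digraph \<Rightarrow> 'a \<Rightarrow> 'a set" where
  "open_nbhd G v = {u. v \<rightarrow>\<^bsub>G\<^esub> u}"

definition closed_nbhd :: "('a, 'b) pre_digraph \<Rightarrow> 'a \<Rightarrow> 'a set" where
  "closed_nbhd G v = insert v (open_nbhd G v)"

definition twins :: "('a, 'b) pre_digraph \<Rightarrow> 'a \<Rightarrow> 'a \<Rightarrow> bool" where
  "twins G v w \<longleftrightarrow> closed_nbhd G v = closed_nbhd G w"

text \<open>Not to be confused with the library's \<open>dominates\<close>, which is mere adjacency.\<close>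

definition nbhd_dominates :: "('a, 'b) pre_digraph \<Rightarrow> 'a \<Rightarrow> 'a \<Rightarrow> bool" where
  "nbhd_dominates G w v \<longleftrightarrow> closed_nbhd G v \<subseteq> closed_nbhd G w"

definition block_separable :: "('a, 'b) pre_digraph \<Rightarrow> 'a \<Rightarrow> bool" where
  "block_separable G v \<longleftrightarrow>
    (\<forall>w \<in> open_nbhd G v. \<forall>z \<in> open_nbhd G v.
      w \<rightarrow>\<^bsub>G\<^esub> z \<and> \<not> nbhd_dominates G w v \<and> \<not> nbhd_dominates G z v \<longrightarrow>
      twins (G \<restriction> open_nbhd G v) w z)"

definition graph_of_edges :: "'a set \<Rightarrow> ('a \<times> 'a) set \<Rightarrow> ('a, 'a \<times> 'a) pre_digraph" where
  "graph_of_edges V E = with_proj (mk_symmetric (with_proj \<lparr>pverts = V, parcs = E\<rparr>))"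

text \<open>The degree-3 vertices of the diamond are 0 and 1.\<close>

definition diamond :: "(nat, nat \<times> nat) pre_digraph" where
  "diamond = graph_of_edges {0, 1, 2, 3} {(0,1), (0,2), (0,3), (1,2), (1,3)}"

definition dart :: "(nat, nat \<times> nat) pre_digraph" where
  "dart = graph_of_edges {0, 1, 2, 3, 4} {(0,1), (0,2), (0,3), (1,2), (1,3), (0,4)}"

text \<open>In \<open>W4\<close> and the gem, 4 is the vertex adjacent to the cycle or path on 0, 1, 2, 3.\<close>

definition W4 :: "(nat, nat \<times> nat) pre_digraph" where
  "W4 = graph_of_edges {0, 1, 2, 3, 4}
    {(0,1), (1,2), (2,3), (3,0), (4,0), (4,1), (4,2), (4,3)}"

definition gem :: "(nat, nat \<times> nat) pre_digraph" where
  "gem = graph_of_edges {0, 1, 2, 3, 4}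
    {(0,1), (1,2), (2,3), (4,0), (4,1), (4,2), (4,3)}"

definition induced_copy ::
    "('a, 'b) pre_digraph \<Rightarrow> ('a, 'b) pre_digraph \<Rightarrow> ('c, 'd) pre_digraph \<Rightarrow> bool" where
  "induced_copy H G F \<longleftrightarrow> induced_subgraph H G \<and> digraph_iso H F"

definition induced_free :: "('c, 'd) pre_digraph set \<Rightarrow> ('a, 'b) pre_digraph \<Rightarrow> bool" where
  "induced_free \<F> G \<longleftrightarrow> (\<forall>F \<in> \<F>. \<not> (\<exists>H. induced_copy H G F))"

lemma mk_symmetric_edges:
  "mk_symmetric (with_proj \<lparr>pverts = V, parcs = E\<rparr>) = \<lparr>pverts = V, parcs = E \<union> E\<inverse>\<rparr>"
proof -
  have "(\<Union>e\<in>E. {(fst e, snd e), (snd e, fst e)}) = E \<union> E\<inverse>"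
    by force
  then show ?thesis
    by (simp add: mk_symmetric_def)
qed

lemma graph_of_edges_is_graph:
  assumes "finite V" "E \<subseteq> V \<times> V" "\<forall>(u, v) \<in> E. u \<noteq> v"
  shows "graph (graph_of_edges V E)"
proof -
  have "finite E"
    using assms finite_subset by blast
  then have "pair_graph \<lparr>pverts = V, parcs = E \<union> E\<inverse>\<rparr>"
    using assms by unfold_locales (auto simp: symmetric_def sym_def)
  then show ?thesis
    unfolding graph_of_edges_def mk_symmetric_edges by (rule pair_graph.pair_graphD_graph)
qed

lemma graph_patterns: "graph diamond" "graph dart" "graph W4" "graph gem"
  by (simp_all add: diamond_def dart_def W4_def gem_def graph_of_edges_is_graph)

end

theory Submission
  imports Defs
begin

text \<open>
  All three statements say that the two degree-3 vertices \<open>a\<close>, \<open>b\<close> of an induced diamond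
  \<open>a, b, c, d\<close> are twins (no other pair of its vertices can be). If \<open>x\<close> is adjacent to \<open>a\<close> but not
  to \<open>b\<close>, then \<open>x\<close> together with the diamond induces a dart, a gem or \<open>W\<^sub>4\<close>, according to whether
  \<open>x\<close> is adjacent to none, one or both of \<open>c\<close>, \<open>d\<close>; moreover the adjacent neighbours \<open>b\<close>, \<open>c\<close> of
  \<open>a\<close> do not dominate \<open>a\<close> and are separated by \<open>d\<close> inside \<open>N(a)\<close>. Conversely, each of the three
  forbidden graphs contains a diamond with such a vertex \<open>x\<close>, and if \<open>x \<in> N(v)\<close> separates two
  adjacent vertices \<open>w, z \<in> N(v)\<close>, then \<open>v, w, z, x\<close> induce a diamond, so that \<open>w\<close>, say, is a twin
  of \<open>v\<close> and dominates it.
\<close>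

section \<open>Induced copies as vertex maps\<close>

text \<open>Only vertices are mapped: without parallel arcs the two ends determine an arc, so a map
  on arcs would add no information. Requiring an equivalence, not just an implication, is what makes
  the copy induced.\<close>

definition induced_embedding ::
    "('c \<Rightarrow> 'a) \<Rightarrow> ('c, 'd) pre_digraph \<Rightarrow> ('a, 'b) pre_digraph \<Rightarrow> bool" where
  "induced_embedding f F G \<longleftrightarrow> inj_on f (verts F) \<and> f ` verts F \<subseteq> verts G \<and>
    (\<forall>u \<in> verts F. \<forall>v \<in> verts F. f u \<rightarrow>\<^bsub>G\<^esub> f v \<longleftrightarrow> u \<rightarrow>\<^bsub>F\<^esub> v)"

lemma dominates_induce_subgraph_iff:
  "u \<rightarrow>\<^bsub>G \<restriction> S\<^esub> v \<longleftrightarrow> u \<rightarrow>\<^bsub>G\<^esub> v \<and> u \<in> S \<and> v \<in> S"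
  by (auto simp: arcs_ends_conv)

lemma dominates_induced_subgraph_iff:
  assumes "induced_subgraph H G"
  shows "u \<rightarrow>\<^bsub>H\<^esub> v \<longleftrightarrow> u \<rightarrow>\<^bsub>G\<^esub> v \<and> u \<in> verts H \<and> v \<in> verts H"
proof -
  have "tail H = tail G" "head H = head G"
    using assms by (auto simp: induced_subgraph_def subgraph_def compatible_def)
  then show ?thesis
    using assms by (auto simp: induced_subgraph_def arcs_ends_conv)
qed

text \<open>The embedding is the vertex part of the inverse isomorphism from \<open>F\<close> back
  to \<open>H\<close>. Its image is recorded as well, because the diamond condition asks for twins
  among the vertices of \<open>H\<close> itself.\<close>

lemma induced_copy_imp_embedding:
  assumes "induced_copy H G F"
  obtains f where "induced_embedding f F G" "verts H = f ` verts F"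
proof -
  obtain h where h: "pre_digraph.digraph_isomorphism H h" and F: "F = app_iso h H"
    using assms by (auto simp: induced_copy_def digraph_iso_def)
  interpret H: wf_digraph H
    using h by (simp add: pre_digraph.digraph_isomorphism_def)
  have ind: "induced_subgraph H G"
    using assms by (simp add: induced_copy_def)
  then have sub: "verts H \<subseteq> verts G"
    by (auto simp: induced_subgraph_def subgraph_def)
  define f where "f = iso_verts (H.inv_iso h)"
  have f: "f (iso_verts h u) = u" if "u \<in> verts H" for u
    using h that by (simp add: f_def)
  have adj: "u \<rightarrow>\<^bsub>G\<^esub> v \<longleftrightarrow> iso_verts h u \<rightarrow>\<^bsub>F\<^esub> iso_verts h v"
    if "u \<in> verts H" "v \<in> verts H" for u v
  proof -
    \<comment> \<open>The arc ends of \<open>F\<close> are the images of those of \<open>H\<close>;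
      injectivity of \<open>iso_verts h\<close> on \<open>verts H\<close> pulls an adjacency
      back.\<close>
    have "iso_verts h u \<rightarrow>\<^bsub>F\<^esub> iso_verts h v \<longleftrightarrow> u \<rightarrow>\<^bsub>H\<^esub> v"
      unfolding F H.arcs_ends_app_iso_eq[OF h]
      using h that H.adj_in_verts by (fastforce simp: image_iff)
    then show ?thesis
      using dominates_induced_subgraph_iff[OF ind] that by simp
  qed
  have "verts H = f ` verts F"
    using f by (force simp: F)
  moreover have "induced_embedding f F G"
    unfolding induced_embedding_def
    using f adj sub by (auto simp: F inj_on_def)
  ultimately show ?thesis
    using that by blast
qed

text \<open>The inverse of \<open>f\<close> on its image extends to arcs in exactly one way: each
  arc goes to the unique arc of \<open>F\<close> between the corresponding ends.\<close>

lemma embedding_imp_induced_copy: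
  assumes "nomulti_digraph G" "nomulti_digraph F" "induced_embedding f F G"
  shows "induced_copy (G \<restriction> f ` verts F) G F"
proof -
  interpret G: nomulti_digraph G by fact
  interpret F: nomulti_digraph F by fact
  let ?S = "f ` verts F"
  let ?H = "G \<restriction> ?S"
  have inj: "inj_on f (verts F)" and sub: "?S \<subseteq> verts G"
    and adj: "\<And>u v. u \<in> verts F \<Longrightarrow> v \<in> verts F \<Longrightarrow> f u \<rightarrow>\<^bsub>G\<^esub> f v \<longleftrightarrow> u \<rightarrow>\<^bsub>F\<^esub> v"
    using assms(3) by (auto simp: induced_embedding_def)
  define g where "g = the_inv_into (verts F) f"
  have g: "g (f u) = u" if "u \<in> verts F" for u
    using inj that by (simp add: g_def the_inv_into_f_f)
  \<comment> \<open>The choice is meaningful only for arcs of \<open>?H\<close>, where a suitable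
    \<open>e'\<close> exists because \<open>f\<close> reflects adjacency.\<close>
  define k where "k e = (SOME e'. e' \<in> arcs F \<and> tail F e' = g (tail G e) \<and> head F e' = g (head G e))"
    for e
  have k: "k e \<in> arcs F \<and> tail F (k e) = g (tail G e) \<and> head F (k e) = g (head G e)"
    if "e \<in> arcs ?H" for e
  proof -
    have "tail G e \<in> ?S" "head G e \<in> ?S"
      using that by simp_all
    then obtain u v where uv: "u \<in> verts F" "v \<in> verts F" "tail G e = f u" "head G e = f v"
      by blast
    then have "u \<rightarrow>\<^bsub>F\<^esub> v"
      using that adj[of u v] by (auto simp: arcs_ends_conv intro: rev_image_eqI)
    then have "\<exists>e'. e' \<in> arcs F \<and> tail F e' = g (tail G e) \<and> head F e' = g (head G e)"
      using uv g by (auto simp: arcs_ends_conv)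
    then show ?thesis
      unfolding k_def by (rule someI_ex)
  qed
  have k_inj: "inj_on k (arcs ?H)"
  proof (rule inj_onI)
    fix e e' assume *: "e \<in> arcs ?H" "e' \<in> arcs ?H" "k e = k e'"
    then have "g (tail G e) = g (tail G e')" "g (head G e) = g (head G e')"
      using k by metis+
    \<comment> \<open>\<open>g\<close> is injective on \<open>?S\<close>, so equal images under
      \<open>k\<close> force equal ends in \<open>G\<close>.\<close>
    then have "arc_to_ends G e = arc_to_ends G e'"
      using * g by (auto simp: arc_to_ends_def)
    then show "e = e'"
      using * G.no_multi_arcs by auto
  qed
  have k_surj: "k ` arcs ?H = arcs F"
  proof (intro equalityI subsetI)
    fix a assume a: "a \<in> arcs F"
    then have "f (tail F a) \<rightarrow>\<^bsub>G\<^esub> f (head F a)"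
      using adj F.wellformed by (auto simp: arcs_ends_conv)
    then obtain e where e: "e \<in> arcs G" "tail G e = f (tail F a)" "head G e = f (head F a)"
      by (auto simp: arcs_ends_conv)
    then have eH: "e \<in> arcs ?H"
      using a by auto
    \<comment> \<open>The preimage of \<open>a\<close> is an arc \<open>e\<close> of
      \<open>G\<close> between the \<open>f\<close>-images of its ends; \<open>k e\<close> is then
      parallel to \<open>a\<close>, hence equal to it.\<close>
    then have "arc_to_ends F (k e) = arc_to_ends F a"
      using k e g a by (auto simp: arc_to_ends_def)
    then show "a \<in> k ` arcs ?H"
      using F.no_multi_arcs k eH a by blast
  qed (use k in blast)
  \<comment> \<open>Head and tail functions are taken from \<open>F\<close>, so that
    \<open>app_iso h ?H\<close> is literally equal to \<open>F\<close>.\<close>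
  define h where "h = \<lparr>iso_verts = g, iso_arcs = k, iso_head = head F, iso_tail = tail F\<rparr>"
  have "pre_digraph.digraph_isomorphism ?H h"
    unfolding pre_digraph.digraph_isomorphism_def h_def
    using k k_inj g G.wellformed_induce_subgraph by (auto simp: inj_on_def)
  moreover have "F = app_iso h ?H"
    using k_surj g by (intro pre_digraph.equality) (auto simp: h_def image_image)
  moreover have "induced_subgraph ?H G"
    using sub by (rule G.induced_induce)
  ultimately show ?thesis
    by (auto simp: induced_copy_def digraph_iso_def)
qed

lemma ex_induced_copy_iff:
  assumes "graph G" "graph F"
  shows "(\<exists>H. induced_copy H G F) \<longleftrightarrow> (\<exists>f. induced_embedding f F G)"
proof -
  interpret G: graph G by fact
  interpret F: graph F by fact
  show ?thesis
    using embedding_imp_induced_copy[OF G.nomulti_digraph_axioms F.nomulti_digraph_axioms]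
    by (meson induced_copy_imp_embedding)
qed

lemma graph_of_edges_simps:
  "verts (graph_of_edges V E) = V"
  "u \<rightarrow>\<^bsub>graph_of_edges V E\<^esub> v \<longleftrightarrow> (u, v) \<in> E \<or> (v, u) \<in> E"
  by (simp_all add: graph_of_edges_def mk_symmetric_edges)

section \<open>Twin hubs of induced diamonds\<close>

text \<open>The common middle term of the three equivalences, phrased with vertices rather than
  subgraphs. Since a graph has no loops, adjacency gives every distinctness in the diamond except
  \<open>c \<noteq> d\<close>.\<close>

definition diamond_hubs_twins :: "('a, 'b) pre_digraph \<Rightarrow> bool" where
  "diamond_hubs_twins G \<longleftrightarrow> (\<forall>a b c d. a \<rightarrow>\<^bsub>G\<^esub> b \<and> a \<rightarrow>\<^bsub>G\<^esub> c \<and> a \<rightarrow>\<^bsub>G\<^esub> d \<and> b \<rightarrow>\<^bsub>G\<^esub> c \<and> b \<rightarrow>\<^bsub>G\<^esub> d \<and>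
    c \<noteq> d \<and> \<not> c \<rightarrow>\<^bsub>G\<^esub> d \<longrightarrow> twins G a b)"

context graph
begin

lemma adj_sym: "u \<rightarrow>\<^bsub>G\<^esub> v \<longleftrightarrow> v \<rightarrow>\<^bsub>G\<^esub> u"
  using graph_symmetric by blast

lemma adj_irrefl: "\<not> u \<rightarrow>\<^bsub>G\<^esub> u"
  using adj_not_same by blast

text \<open>The exception \<open>x \<noteq> b\<close> reflects that \<open>b\<close> lies in its own
  closed neighborhood without being adjacent to itself.\<close>

lemma diamond_hubs_twinsD:
  assumes "diamond_hubs_twins G" "a \<rightarrow>\<^bsub>G\<^esub> b" "a \<rightarrow>\<^bsub>G\<^esub> c" "a \<rightarrow>\<^bsub>G\<^esub> d" "b \<rightarrow>\<^bsub>G\<^esub> c" "b \<rightarrow>\<^bsub>G\<^esub> d"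
    "c \<noteq> d" "\<not> c \<rightarrow>\<^bsub>G\<^esub> d" "a \<rightarrow>\<^bsub>G\<^esub> x" "x \<noteq> b"
  shows "b \<rightarrow>\<^bsub>G\<^esub> x"
proof -
  have "twins G a b"
    using assms unfolding diamond_hubs_twins_def by blast
  then show ?thesis
    using assms by (auto simp: twins_def closed_nbhd_def open_nbhd_def)
qed

text \<open>A vertex separating the hubs may be adjacent to either one; the diamond is symmetric in
  its hubs, so they can be named such that it is adjacent to \<open>a\<close>.\<close>

lemma not_diamond_hubs_twinsE:
  assumes "\<not> diamond_hubs_twins G"
  obtains a b c d x where "a \<rightarrow>\<^bsub>G\<^esub> b" "a \<rightarrow>\<^bsub>G\<^esub> c" "a \<rightarrow>\<^bsub>G\<^esub> d" "b \<rightarrow>\<^bsub>G\<^esub> c" "b \<rightarrow>\<^bsub>G\<^esub> d"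
    "c \<noteq> d" "\<not> c \<rightarrow>\<^bsub>G\<^esub> d" "a \<rightarrow>\<^bsub>G\<^esub> x" "x \<noteq> b" "\<not> b \<rightarrow>\<^bsub>G\<^esub> x"
proof -
  obtain a b c d where *: "a \<rightarrow>\<^bsub>G\<^esub> b" "a \<rightarrow>\<^bsub>G\<^esub> c" "a \<rightarrow>\<^bsub>G\<^esub> d" "b \<rightarrow>\<^bsub>G\<^esub> c" "b \<rightarrow>\<^bsub>G\<^esub> d"
    "c \<noteq> d" "\<not> c \<rightarrow>\<^bsub>G\<^esub> d" and "\<not> twins G a b"
    using assms unfolding diamond_hubs_twins_def by blast
  then obtain x where "a \<rightarrow>\<^bsub>G\<^esub> x \<and> x \<noteq> b \<and> \<not> b \<rightarrow>\<^bsub>G\<^esub> x \<or> b \<rightarrow>\<^bsub>G\<^esub> x \<and> x \<noteq> a \<and> \<not> a \<rightarrow>\<^bsub>G\<^esub> x"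
    using adj_sym[of a b] by (auto simp: twins_def closed_nbhd_def open_nbhd_def)
  then show ?thesis
    using * that[of a b c d x] that[of b a c d x] adj_sym[of a b] by blast
qed

text \<open>List indexing encodes the map: pattern vertex \<open>i\<close> goes to entry
  \<open>i\<close>, counted from 0, so the hubs 0 and 1 go to \<open>a\<close> and
  \<open>b\<close>.\<close>

lemma embedding_diamondI:
  assumes "a \<rightarrow>\<^bsub>G\<^esub> b" "a \<rightarrow>\<^bsub>G\<^esub> c" "a \<rightarrow>\<^bsub>G\<^esub> d" "b \<rightarrow>\<^bsub>G\<^esub> c" "b \<rightarrow>\<^bsub>G\<^esub> d" "c \<noteq> d" "\<not> c \<rightarrow>\<^bsub>G\<^esub> d"
  shows "induced_embedding ((!) [a, b, c, d]) diamond G"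
proof -
  have "b \<rightarrow>\<^bsub>G\<^esub> a" "c \<rightarrow>\<^bsub>G\<^esub> a" "d \<rightarrow>\<^bsub>G\<^esub> a" "c \<rightarrow>\<^bsub>G\<^esub> b" "d \<rightarrow>\<^bsub>G\<^esub> b" "\<not> d \<rightarrow>\<^bsub>G\<^esub> c"
    using assms adj_sym by simp_all
  moreover have "{a, b, c, d} \<subseteq> verts G"
    using assms adj_in_verts by blast
  moreover have "distinct [a, b, c, d]"
    using assms adj_irrefl by auto
  ultimately show ?thesis
    using assms adj_irrefl
    by (simp add: induced_embedding_def diamond_def graph_of_edges_simps inj_on_def numeral_3_eq_3)
      blast
qed

lemma every_diamond_twins_iff:
  "(\<forall>H. induced_copy H G diamond \<longrightarrow> (\<exists>x \<in> verts H. \<exists>y \<in> verts H. x \<noteq> y \<and> twins G x y))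
    \<longleftrightarrow> diamond_hubs_twins G" (is "?L \<longleftrightarrow> _")
proof
  assume L: ?L
  interpret D: graph diamond by (rule graph_patterns)
  show "diamond_hubs_twins G"
  proof (unfold diamond_hubs_twins_def, intro allI impI, elim conjE)
    fix a b c d
    assume *: "a \<rightarrow>\<^bsub>G\<^esub> b" "a \<rightarrow>\<^bsub>G\<^esub> c" "a \<rightarrow>\<^bsub>G\<^esub> d" "b \<rightarrow>\<^bsub>G\<^esub> c" "b \<rightarrow>\<^bsub>G\<^esub> d" "c \<noteq> d" "\<not> c \<rightarrow>\<^bsub>G\<^esub> d"
    let ?f = "(!) [a, b, c, d]"
    have "induced_copy (G \<restriction> ?f ` verts diamond) G diamond"
      using embedding_imp_induced_copy[OF nomulti_digraph_axioms D.nomulti_digraph_axioms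
          embedding_diamondI[OF *]] .
    moreover have "?f ` verts diamond = {a, b, c, d}"
      by (auto simp: diamond_def graph_of_edges_simps numeral_3_eq_3)
    ultimately have "induced_copy (G \<restriction> {a, b, c, d}) G diamond"
      by metis
    then have "\<exists>x \<in> {a, b, c, d}. \<exists>y \<in> {a, b, c, d}. x \<noteq> y \<and> twins G x y"
      using L by (metis induce_subgraph_verts)
    then obtain x y where xy: "x \<in> {a, b, c, d}" "y \<in> {a, b, c, d}" "x \<noteq> y"
      and tw: "twins G x y"
      by blast
    have sym: "b \<rightarrow>\<^bsub>G\<^esub> a" "c \<rightarrow>\<^bsub>G\<^esub> a" "d \<rightarrow>\<^bsub>G\<^esub> a" "c \<rightarrow>\<^bsub>G\<^esub> b" "d \<rightarrow>\<^bsub>G\<^esub> b" "\<not> d \<rightarrow>\<^bsub>G\<^esub> c"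
      using * adj_sym by simp_all
    have nbhd: "u = x \<or> x \<rightarrow>\<^bsub>G\<^esub> u \<longleftrightarrow> u = y \<or> y \<rightarrow>\<^bsub>G\<^esub> u" for u
      using tw by (auto simp: twins_def closed_nbhd_def open_nbhd_def)
    \<comment> \<open>Every other pair is separated by \<open>c\<close> or \<open>d\<close>: a hub
      and \<open>c\<close> by \<open>d\<close>, a hub and \<open>d\<close> by \<open>c\<close>, and
      the nonadjacent pair \<open>c\<close>, \<open>d\<close> by either of them.\<close>
    have "{x, y} = {a, b}"
      using xy * sym nbhd[of c] nbhd[of d] by auto
    then show "twins G a b"
      using tw by (auto simp: twins_def doubleton_eq_iff)
  qed
next
  assume R: "diamond_hubs_twins G"
  show ?L
  proof (intro allI impI)
    fix H assume "induced_copy H G diamond"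
    then obtain f where f: "induced_embedding f diamond G" and H: "verts H = f ` verts diamond"
      by (rule induced_copy_imp_embedding)
    have "f 0 \<rightarrow>\<^bsub>G\<^esub> f 1" "f 0 \<rightarrow>\<^bsub>G\<^esub> f 2" "f 0 \<rightarrow>\<^bsub>G\<^esub> f 3" "f 1 \<rightarrow>\<^bsub>G\<^esub> f 2" "f 1 \<rightarrow>\<^bsub>G\<^esub> f 3"
      "f 2 \<noteq> f 3" "\<not> f 2 \<rightarrow>\<^bsub>G\<^esub> f 3"
      using f by (simp_all add: induced_embedding_def diamond_def graph_of_edges_simps inj_on_def)
    then have "twins G (f 0) (f 1)" "f 0 \<noteq> f 1"
      using R adj_irrefl unfolding diamond_hubs_twins_def by metis+
    moreover have "f 0 \<in> verts H" "f 1 \<in> verts H"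
      by (auto simp: H diamond_def graph_of_edges_simps)
    ultimately show "\<exists>x \<in> verts H. \<exists>y \<in> verts H. x \<noteq> y \<and> twins G x y"
      by blast
  qed
qed

section \<open>Forbidden five-vertex subgraphs\<close>

lemma embedding_dartI:
  assumes "a \<rightarrow>\<^bsub>G\<^esub> b" "a \<rightarrow>\<^bsub>G\<^esub> c" "a \<rightarrow>\<^bsub>G\<^esub> d" "b \<rightarrow>\<^bsub>G\<^esub> c" "b \<rightarrow>\<^bsub>G\<^esub> d" "c \<noteq> d" "\<not> c \<rightarrow>\<^bsub>G\<^esub> d"
    "a \<rightarrow>\<^bsub>G\<^esub> x" "x \<noteq> b" "\<not> b \<rightarrow>\<^bsub>G\<^esub> x" "\<not> c \<rightarrow>\<^bsub>G\<^esub> x" "\<not> d \<rightarrow>\<^bsub>G\<^esub> x"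
  shows "induced_embedding ((!) [a, b, c, d, x]) dart G"
proof -
  have "b \<rightarrow>\<^bsub>G\<^esub> a" "c \<rightarrow>\<^bsub>G\<^esub> a" "d \<rightarrow>\<^bsub>G\<^esub> a" "c \<rightarrow>\<^bsub>G\<^esub> b" "d \<rightarrow>\<^bsub>G\<^esub> b" "\<not> d \<rightarrow>\<^bsub>G\<^esub> c" "x \<rightarrow>\<^bsub>G\<^esub> a"
    "\<not> x \<rightarrow>\<^bsub>G\<^esub> b" "\<not> x \<rightarrow>\<^bsub>G\<^esub> c" "\<not> x \<rightarrow>\<^bsub>G\<^esub> d"
    using assms adj_sym by simp_all
  moreover have "{a, b, c, d, x} \<subseteq> verts G"
    using assms adj_in_verts by blast
  moreover have "distinct [a, b, c, d, x]"
    using assms adj_irrefl by auto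
  ultimately show ?thesis
    using assms adj_irrefl
    by (simp add: induced_embedding_def dart_def graph_of_edges_simps inj_on_def eval_nat_numeral)
      blast
qed

text \<open>Here \<open>x\<close>, \<open>c\<close>, \<open>b\<close>, \<open>d\<close> is the
  induced path, and \<open>a\<close> is the vertex adjacent to all of it.\<close>

lemma embedding_gemI:
  assumes "a \<rightarrow>\<^bsub>G\<^esub> b" "a \<rightarrow>\<^bsub>G\<^esub> c" "a \<rightarrow>\<^bsub>G\<^esub> d" "b \<rightarrow>\<^bsub>G\<^esub> c" "b \<rightarrow>\<^bsub>G\<^esub> d" "c \<noteq> d" "\<not> c \<rightarrow>\<^bsub>G\<^esub> d"
    "a \<rightarrow>\<^bsub>G\<^esub> x" "x \<noteq> b" "\<not> b \<rightarrow>\<^bsub>G\<^esub> x" "c \<rightarrow>\<^bsub>G\<^esub> x" "\<not> d \<rightarrow>\<^bsub>G\<^esub> x"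
  shows "induced_embedding ((!) [x, c, b, d, a]) gem G"
proof -
  have "b \<rightarrow>\<^bsub>G\<^esub> a" "c \<rightarrow>\<^bsub>G\<^esub> a" "d \<rightarrow>\<^bsub>G\<^esub> a" "c \<rightarrow>\<^bsub>G\<^esub> b" "d \<rightarrow>\<^bsub>G\<^esub> b" "\<not> d \<rightarrow>\<^bsub>G\<^esub> c" "x \<rightarrow>\<^bsub>G\<^esub> a"
    "\<not> x \<rightarrow>\<^bsub>G\<^esub> b" "x \<rightarrow>\<^bsub>G\<^esub> c" "\<not> x \<rightarrow>\<^bsub>G\<^esub> d"
    using assms adj_sym by simp_all
  moreover have "{a, b, c, d, x} \<subseteq> verts G"
    using assms adj_in_verts by blast
  moreover have "distinct [x, c, b, d, a]"
    using assms adj_irrefl by auto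
  ultimately show ?thesis
    using assms adj_irrefl
    by (simp add: induced_embedding_def gem_def graph_of_edges_simps inj_on_def eval_nat_numeral)
      blast
qed

text \<open>The same order as for the gem; the additional edge between \<open>d\<close> and
  \<open>x\<close> closes the path to a 4-cycle.\<close>

lemma embedding_W4I:
  assumes "a \<rightarrow>\<^bsub>G\<^esub> b" "a \<rightarrow>\<^bsub>G\<^esub> c" "a \<rightarrow>\<^bsub>G\<^esub> d" "b \<rightarrow>\<^bsub>G\<^esub> c" "b \<rightarrow>\<^bsub>G\<^esub> d" "c \<noteq> d" "\<not> c \<rightarrow>\<^bsub>G\<^esub> d"
    "a \<rightarrow>\<^bsub>G\<^esub> x" "x \<noteq> b" "\<not> b \<rightarrow>\<^bsub>G\<^esub> x" "c \<rightarrow>\<^bsub>G\<^esub> x" "d \<rightarrow>\<^bsub>G\<^esub> x"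
  shows "induced_embedding ((!) [x, c, b, d, a]) W4 G"
proof -
  have "b \<rightarrow>\<^bsub>G\<^esub> a" "c \<rightarrow>\<^bsub>G\<^esub> a" "d \<rightarrow>\<^bsub>G\<^esub> a" "c \<rightarrow>\<^bsub>G\<^esub> b" "d \<rightarrow>\<^bsub>G\<^esub> b" "\<not> d \<rightarrow>\<^bsub>G\<^esub> c" "x \<rightarrow>\<^bsub>G\<^esub> a"
    "\<not> x \<rightarrow>\<^bsub>G\<^esub> b" "x \<rightarrow>\<^bsub>G\<^esub> c" "x \<rightarrow>\<^bsub>G\<^esub> d"
    using assms adj_sym by simp_all
  moreover have "{a, b, c, d, x} \<subseteq> verts G"
    using assms adj_in_verts by blast
  moreover have "distinct [x, c, b, d, a]"
    using assms adj_irrefl by auto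
  ultimately show ?thesis
    using assms adj_irrefl
    by (simp add: induced_embedding_def W4_def graph_of_edges_simps inj_on_def eval_nat_numeral)
      blast
qed

lemma induced_free_iff:
  "induced_free {W4, dart, gem} G \<longleftrightarrow> diamond_hubs_twins G"
proof -
  have free: "induced_free {W4, dart, gem} G \<longleftrightarrow> (\<nexists>f. induced_embedding f W4 G) \<and>
      (\<nexists>f. induced_embedding f dart G) \<and> (\<nexists>f. induced_embedding f gem G)"
    by (simp add: induced_free_def ex_induced_copy_iff[OF graph_axioms] graph_patterns
        del: not_ex)
  show ?thesis
    unfolding free
  proof
    assume *: "(\<nexists>f. induced_embedding f W4 G) \<and>
      (\<nexists>f. induced_embedding f dart G) \<and> (\<nexists>f. induced_embedding f gem G)"
    show "diamond_hubs_twins G"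
    proof (rule ccontr)
      assume "\<not> diamond_hubs_twins G"
      then obtain a b c d x where d: "a \<rightarrow>\<^bsub>G\<^esub> b" "a \<rightarrow>\<^bsub>G\<^esub> c" "a \<rightarrow>\<^bsub>G\<^esub> d" "b \<rightarrow>\<^bsub>G\<^esub> c" "b \<rightarrow>\<^bsub>G\<^esub> d"
        "c \<noteq> d" "\<not> c \<rightarrow>\<^bsub>G\<^esub> d" "a \<rightarrow>\<^bsub>G\<^esub> x" "x \<noteq> b" "\<not> b \<rightarrow>\<^bsub>G\<^esub> x"
        by (rule not_diamond_hubs_twinsE)
      have "\<not> d \<rightarrow>\<^bsub>G\<^esub> c"
        using d adj_sym by blast
      then show False
        \<comment> \<open>The four cases for the adjacency of \<open>x\<close> to \<open>c\<close>
          and \<open>d\<close>. The gem occurs twice, the second time with \<open>c\<close> and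
          \<open>d\<close> exchanged.\<close>
        using * d embedding_dartI[of a b c d x] embedding_gemI[of a b c d x]
          embedding_gemI[of a b d c x] embedding_W4I[of a b c d x] by metis
    qed
  next
    assume R: "diamond_hubs_twins G"
    have False if "induced_embedding f W4 G" for f
    proof -
      \<comment> \<open>The hubs are the center 4 and the cycle vertex 1, with 0 and 2 as the other
        diamond vertices; 3, opposite 1 on the cycle, is adjacent to only one hub.\<close>
      have "f 4 \<rightarrow>\<^bsub>G\<^esub> f 1" "f 4 \<rightarrow>\<^bsub>G\<^esub> f 0" "f 4 \<rightarrow>\<^bsub>G\<^esub> f 2" "f 1 \<rightarrow>\<^bsub>G\<^esub> f 0" "f 1 \<rightarrow>\<^bsub>G\<^esub> f 2"
        "f 0 \<noteq> f 2" "\<not> f 0 \<rightarrow>\<^bsub>G\<^esub> f 2" "f 4 \<rightarrow>\<^bsub>G\<^esub> f 3" "f 3 \<noteq> f 1" "\<not> f 1 \<rightarrow>\<^bsub>G\<^esub> f 3"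
        using that by (simp_all add: induced_embedding_def W4_def graph_of_edges_simps inj_on_def)
      then show False
        using diamond_hubs_twinsD[OF R] by blast
    qed
    moreover have False if "induced_embedding f dart G" for f
    proof -
      \<comment> \<open>The diamond is the one on 0, 1, 2, 3; the pendant vertex 4 sees only the hub
        0.\<close>
      have "f 0 \<rightarrow>\<^bsub>G\<^esub> f 1" "f 0 \<rightarrow>\<^bsub>G\<^esub> f 2" "f 0 \<rightarrow>\<^bsub>G\<^esub> f 3" "f 1 \<rightarrow>\<^bsub>G\<^esub> f 2" "f 1 \<rightarrow>\<^bsub>G\<^esub> f 3"
        "f 2 \<noteq> f 3" "\<not> f 2 \<rightarrow>\<^bsub>G\<^esub> f 3" "f 0 \<rightarrow>\<^bsub>G\<^esub> f 4" "f 4 \<noteq> f 1" "\<not> f 1 \<rightarrow>\<^bsub>G\<^esub> f 4"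
        using that by (simp_all add: induced_embedding_def dart_def graph_of_edges_simps inj_on_def)
      then show False
        using diamond_hubs_twinsD[OF R] by blast
    qed
    moreover have False if "induced_embedding f gem G" for f
    proof -
      \<comment> \<open>The same choice as in \<open>W4\<close> works, as it does not involve the
        pair 0, 3, the only one in which the two graphs differ.\<close>
      have "f 4 \<rightarrow>\<^bsub>G\<^esub> f 1" "f 4 \<rightarrow>\<^bsub>G\<^esub> f 0" "f 4 \<rightarrow>\<^bsub>G\<^esub> f 2" "f 1 \<rightarrow>\<^bsub>G\<^esub> f 0" "f 1 \<rightarrow>\<^bsub>G\<^esub> f 2"
        "f 0 \<noteq> f 2" "\<not> f 0 \<rightarrow>\<^bsub>G\<^esub> f 2" "f 4 \<rightarrow>\<^bsub>G\<^esub> f 3" "f 3 \<noteq> f 1" "\<not> f 1 \<rightarrow>\<^bsub>G\<^esub> f 3"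
        using that by (simp_all add: induced_embedding_def gem_def graph_of_edges_simps inj_on_def)
      then show False
        using diamond_hubs_twinsD[OF R] by blast
    qed
    ultimately show "(\<nexists>f. induced_embedding f W4 G) \<and>
      (\<nexists>f. induced_embedding f dart G) \<and> (\<nexists>f. induced_embedding f gem G)"
      by blast
  qed
qed

section \<open>Block separability\<close>

lemma block_separable_iff:
  "(\<forall>v \<in> verts G. block_separable G v) \<longleftrightarrow> diamond_hubs_twins G"
proof
  assume L: "\<forall>v \<in> verts G. block_separable G v"
  show "diamond_hubs_twins G"
  proof (rule ccontr)
    assume "\<not> diamond_hubs_twins G"
    then obtain a b c d x where *: "a \<rightarrow>\<^bsub>G\<^esub> b" "a \<rightarrow>\<^bsub>G\<^esub> c" "a \<rightarrow>\<^bsub>G\<^esub> d" "b \<rightarrow>\<^bsub>G\<^esub> c" "b \<rightarrow>\<^bsub>G\<^esub> d"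
      "c \<noteq> d" "\<not> c \<rightarrow>\<^bsub>G\<^esub> d" "a \<rightarrow>\<^bsub>G\<^esub> x" "x \<noteq> b" "\<not> b \<rightarrow>\<^bsub>G\<^esub> x"
      by (rule not_diamond_hubs_twinsE)
    have "block_separable G a"
      using L * adj_in_verts by blast
    \<comment> \<open>The vertex of \<open>N[a]\<close> that is missed is \<open>x\<close> for
      \<open>b\<close> and \<open>d\<close> for \<open>c\<close>.\<close>
    moreover have "\<not> nbhd_dominates G b a" "\<not> nbhd_dominates G c a"
      using * by (auto simp: nbhd_dominates_def closed_nbhd_def open_nbhd_def)
    ultimately have "twins (G \<restriction> open_nbhd G a) b c"
      using * unfolding block_separable_def by (auto simp: open_nbhd_def)
    moreover have "d \<in> closed_nbhd (G \<restriction> open_nbhd G a) b"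
      using * by (simp add: closed_nbhd_def open_nbhd_def dominates_induce_subgraph_iff)
    ultimately have "d \<in> closed_nbhd (G \<restriction> open_nbhd G a) c"
      by (simp add: twins_def)
    then have "c = d \<or> c \<rightarrow>\<^bsub>G\<^esub> d"
      by (auto simp: closed_nbhd_def open_nbhd_def dominates_induce_subgraph_iff)
    then show False
      using * by blast
  qed
next
  assume R: "diamond_hubs_twins G"
  \<comment> \<open>One inclusion between the closed neighborhoods of \<open>z\<close> and
    \<open>w\<close> inside \<open>N(v)\<close>. If it failed at \<open>x\<close>, then
    \<open>v\<close> and \<open>z\<close> would be the hubs of a diamond with \<open>w\<close> and
    \<open>x\<close>, hence twins, and \<open>z\<close> would dominate \<open>v\<close>.\<close>
  have *: "w = x \<or> w \<rightarrow>\<^bsub>G\<^esub> x" if "v \<rightarrow>\<^bsub>G\<^esub> w" "v \<rightarrow>\<^bsub>G\<^esub> z" "w \<rightarrow>\<^bsub>G\<^esub> z" "v \<rightarrow>\<^bsub>G\<^esub> x" "z \<rightarrow>\<^bsub>G\<^esub> x"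
    "\<not> nbhd_dominates G z v" for v w x z
  proof (rule ccontr)
    assume "\<not> (w = x \<or> w \<rightarrow>\<^bsub>G\<^esub> x)"
    then have "twins G v z"
      using that R adj_sym[of w z] unfolding diamond_hubs_twins_def by metis
    then show False
      using that by (simp add: twins_def nbhd_dominates_def)
  qed
  show "\<forall>v \<in> verts G. block_separable G v"
  proof (unfold block_separable_def, intro ballI impI, elim conjE)
    fix v w z
    assume "w \<in> open_nbhd G v" "z \<in> open_nbhd G v" "w \<rightarrow>\<^bsub>G\<^esub> z"
      "\<not> nbhd_dominates G w v" "\<not> nbhd_dominates G z v"
    then show "twins (G \<restriction> open_nbhd G v) w z"
      \<comment> \<open>Exchanging \<open>w\<close> and \<open>z\<close> gives the opposite
        inclusion; this is why neither of them may dominate \<open>v\<close>.\<close>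
      using *[of v w z] *[of v z w] adj_sym[of w z]
      by (auto simp: twins_def closed_nbhd_def open_nbhd_def dominates_induce_subgraph_iff)
  qed
qed

end

theorem theorem22:
  fixes G :: "('a, 'b) pre_digraph"
  assumes "graph G"
  shows "(induced_free {W4, dart, gem} G \<longleftrightarrow>
          (\<forall>H. induced_copy H G diamond \<longrightarrow>
            (\<exists>x \<in> verts H. \<exists>y \<in> verts H. x \<noteq> y \<and> twins G x y))) \<and>
         ((\<forall>H. induced_copy H G diamond \<longrightarrow>
            (\<exists>x \<in> verts H. \<exists>y \<in> verts H. x \<noteq> y \<and> twins G x y)) \<longleftrightarrow>
          (\<forall>v \<in> verts G. block_separable G v))"
proof -
  interpret graph G by fact
  show ?thesis
    unfolding every_diamond_twins_iff induced_free_iff block_separable_iff by simp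
qed

end
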